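(* Let $W$ be a Coxeter group with a finite set of simple reflections $S$, let $I,J\subset S$, and let $\psi\colon W_I\to W_J$ be an isomorphism of groups with $\psi(I)=J$. Then ${}^{I}W$ is a set of representatives for the equivalence classes in $W$ with respect to the equivalence relation $\sim$ attached to the abstract zip datum $(W,W_I,\psi)$.
   Context: For $K\subset S$, $W_K$ is the subgroup of $W$ generated by $K$; ${}^{I}W$ is the set of $w\in W$ of minimal length in the coset $W_Iw$. For $w\in W$, $E_w$ denotes the unique largest subgroup $E$ of $w^{-1}W_Iw$ satisfying $\psi(wEw^{-1})=E$ (the subgroup generated by all such subgroups). For $w,w'\in W$ write $w'\sim w$ if and only if there exist $\delta\in W_I$ and $\epsilon\in E_w$ with $w'=\delta w\epsilon\psi(\delta)^{-1}$. This is an equivalence relation on $W$. *)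

theory Defs
  imports "HOL-Algebra.Algebra"
begin

definition word_eval :: "('a, 'b) monoid_scheme \<Rightarrow> 'a list \<Rightarrow> 'a" where
  "word_eval G xs = foldr (\<lambda>x y. x \<otimes>\<^bsub>G\<^esub> y) xs \<one>\<^bsub>G\<^esub>"

text \<open>
  The equivalence relation on words over S generated by inserting and deleting the words
  (s t) (s t) ... (s t) with m(s,t) factors, where m(s,t) is the order of s t in G.
  If s t has infinite order then \<open>group.ord\<close> is 0 and no relation is imposed.
  For s = t of order 2 the relation is s s = 1, so formal inverses of letters are not needed
  and the words modulo this relation are the group with generators S and relations
  (s t)^m(s,t) = 1.
\<close>
inductive coxeter_equiv :: "('a, 'b) monoid_scheme \<Rightarrow> 'a set \<Rightarrow> 'a list \<Rightarrow> 'a list \<Rightarrow> bool"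
  for G (structure) and S where
  refl: "xs \<in> lists S \<Longrightarrow> coxeter_equiv G S xs xs"
| sym: "coxeter_equiv G S xs ys \<Longrightarrow> coxeter_equiv G S ys xs"
| trans: "coxeter_equiv G S xs ys \<Longrightarrow> coxeter_equiv G S ys zs \<Longrightarrow> coxeter_equiv G S xs zs"
| delete: "us \<in> lists S \<Longrightarrow> vs \<in> lists S \<Longrightarrow> s \<in> S \<Longrightarrow> t \<in> S \<Longrightarrow>
    coxeter_equiv G S (us @ concat (replicate (group.ord G (s \<otimes> t)) [s, t]) @ vs) (us @ vs)"

text \<open>
  Coxeter systems in the sense of Bourbaki: S consists of elements of order 2, generates G,
  and the relations (s t)^m(s,t) = 1 form a presentation of G.
\<close>
locale coxeter_system = group G for G (structure) +
  fixes S :: "'a set"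
  assumes S_subset: "S \<subseteq> carrier G"
    and S_order_two: "\<And>s. s \<in> S \<Longrightarrow> ord s = 2"
    and S_generates: "generate G S = carrier G"
    and S_presents: "\<And>xs ys. xs \<in> lists S \<Longrightarrow> ys \<in> lists S \<Longrightarrow>
      word_eval G xs = word_eval G ys \<Longrightarrow> coxeter_equiv G S xs ys"

definition word_length :: "('a, 'b) monoid_scheme \<Rightarrow> 'a set \<Rightarrow> 'a \<Rightarrow> nat" where
  "word_length G S w = (LEAST n. \<exists>xs \<in> lists S. length xs = n \<and> word_eval G xs = w)"

definition min_left_reps :: "('a, 'b) monoid_scheme \<Rightarrow> 'a set \<Rightarrow> 'a set \<Rightarrow> 'a set" where
  "min_left_reps G S I =
    {w \<in> carrier G. \<forall>v \<in> generate G I #>\<^bsub>G\<^esub> w. word_length G S w \<le> word_length G S v}"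

definition conj_set :: "('a, 'b) monoid_scheme \<Rightarrow> 'a \<Rightarrow> 'a set \<Rightarrow> 'a set" where
  "conj_set G g H = (\<lambda>x. g \<otimes>\<^bsub>G\<^esub> x \<otimes>\<^bsub>G\<^esub> inv\<^bsub>G\<^esub> g) ` H"

text \<open>The subgroup E_w. Only the values of \<open>\<psi>\<close> on \<open>generate G I\<close> matter here.\<close>
definition zip_stab :: "('a, 'b) monoid_scheme \<Rightarrow> 'a set \<Rightarrow> ('a \<Rightarrow> 'a) \<Rightarrow> 'a \<Rightarrow> 'a set" where
  "zip_stab G I \<psi> w = generate G (\<Union>{E. subgroup E G \<and>
      E \<subseteq> conj_set G (inv\<^bsub>G\<^esub> w) (generate G I) \<and> \<psi> ` conj_set G w E = E})"

definition zip_equiv :: "('a, 'b) monoid_scheme \<Rightarrow> 'a set \<Rightarrow> ('a \<Rightarrow> 'a) \<Rightarrow> ('a \<times> 'a) set" where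
  "zip_equiv G I \<psi> = {(w', w). w' \<in> carrier G \<and> w \<in> carrier G \<and>
      (\<exists>\<delta> \<in> generate G I. \<exists>\<epsilon> \<in> zip_stab G I \<psi> w.
         w' = \<delta> \<otimes>\<^bsub>G\<^esub> w \<otimes>\<^bsub>G\<^esub> \<epsilon> \<otimes>\<^bsub>G\<^esub> inv\<^bsub>G\<^esub> (\<psi> \<delta>))}"

definition representatives :: "'a set \<Rightarrow> ('a \<times> 'a) set \<Rightarrow> 'a set \<Rightarrow> bool" where
  "representatives A r R \<longleftrightarrow> R \<subseteq> A \<and> (\<forall>C \<in> A // r. \<exists>!x. x \<in> R \<and> x \<in> C)"

end

theory Submission
  imports Defs
begin

text \<open>
  The proof reduces the zip datum to smaller ones. Put \<open>J = \<psi>(I)\<close> and let \<open>y\<close> have minimal length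
  in \<open>W\<^sub>I w W\<^sub>J\<close>. By the lemmas of Deodhar and Kilmoyer, \<open>W\<^sub>J \<inter> y\<^sup>-\<^sup>1 W\<^sub>I y = W\<^sub>I\<^sub>'\<close> for
  \<open>I' = J \<inter> y\<^sup>-\<^sup>1 I y\<close>, and \<open>u \<mapsto> y u\<close> is a bijection from the elements of \<open>W\<^sub>J\<close>
  that have minimal length in their coset \<open>W\<^sub>I\<^sub>' u\<close> to the elements of \<open>\<^sup>IW\<close> in the double coset. Setting
  \<open>\<psi>'(v) = \<psi>(y v y\<^sup>-\<^sup>1)\<close>, one gets \<open>a y b \<sim> y u\<close> if and only if \<open>b \<psi>(a) \<sim> u\<close> for the datum
  \<open>(W\<^sub>J, W\<^sub>I\<^sub>', \<psi>')\<close>. Either \<open>|I'| < |I|\<close>, or \<open>I' = J\<close>; in the latter case \<open>\<psi>'\<close> is an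
  automorphism of \<open>W\<^sub>J\<close>, so that \<open>E = W\<^sub>J\<close> and there is a single class, represented by \<open>1\<close>.
\<close>

section \<open>Words and conjugation in an arbitrary group\<close>

context group
begin

lemma word_eval_Nil [simp]: "word_eval G [] = \<one>"
  by (simp add: word_eval_def)

lemma word_eval_Cons [simp]: "word_eval G (x # xs) = x \<otimes> word_eval G xs"
  by (simp add: word_eval_def)

lemma word_eval_closed [simp, intro]: "set xs \<subseteq> carrier G \<Longrightarrow> word_eval G xs \<in> carrier G"
  by (induction xs) auto

lemma word_eval_append:
  "set xs \<subseteq> carrier G \<Longrightarrow> set ys \<subseteq> carrier G \<Longrightarrow>
    word_eval G (xs @ ys) = word_eval G xs \<otimes> word_eval G ys"
  by (induction xs) (auto simp: m_assoc)

lemma inv_mult_cancel [simp]: "x \<in> carrier G \<Longrightarrow> y \<in> carrier G \<Longrightarrow> inv x \<otimes> (x \<otimes> y) = y"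
  by (simp flip: m_assoc)

lemma mult_inv_cancel [simp]: "x \<in> carrier G \<Longrightarrow> y \<in> carrier G \<Longrightarrow> x \<otimes> (inv x \<otimes> y) = y"
  by (simp flip: m_assoc)

lemma conj_set_mult:
  assumes "x \<in> carrier G" "y \<in> carrier G" "H \<subseteq> carrier G"
  shows "conj_set G (x \<otimes> y) H = conj_set G x (conj_set G y H)"
  unfolding conj_set_def image_image
  by (rule image_cong) (use assms in \<open>auto simp: inv_mult_group m_assoc subset_iff\<close>)

text \<open>Moves the containment in the definition of \<open>zip_stab\<close> onto the set that
  \<psi> is applied to, so that conjugations by a product can be split.\<close>

lemma subset_conj_set_inv_iff:
  assumes "w \<in> carrier G" "E \<subseteq> carrier G" "H \<subseteq> carrier G"
  shows "E \<subseteq> conj_set G (inv w) H \<longleftrightarrow> conj_set G w E \<subseteq> H"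
proof
  assume "E \<subseteq> conj_set G (inv w) H"
  then have "\<exists>h\<in>H. e = inv w \<otimes> h \<otimes> w" if "e \<in> E" for e
    using that assms(1) by (auto simp: conj_set_def)
  then show "conj_set G w E \<subseteq> H"
    using assms by (fastforce simp: conj_set_def m_assoc)
next
  assume "conj_set G w E \<subseteq> H"
  moreover have "e = inv w \<otimes> (w \<otimes> e \<otimes> inv w) \<otimes> inv (inv w)" if "e \<in> E" for e
    using that assms by (auto simp: m_assoc)
  ultimately show "E \<subseteq> conj_set G (inv w) H"
    by (auto simp: conj_set_def)
qed

text \<open>Extends control of images from generators to the generated subgroup, for conjugation by
  y and for \<psi>. As f is multiplicative only on that subgroup, it is treated as a homomorphism
  from the restricted structure.\<close>

lemma generate_image_subset:
  assumes "I \<subseteq> carrier G" "f ` I \<subseteq> generate G K" "K \<subseteq> carrier G"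
    and "\<And>a b. a \<in> generate G I \<Longrightarrow> b \<in> generate G I \<Longrightarrow> f (a \<otimes> b) = f a \<otimes> f b"
    and "a \<in> generate G I"
    and "f ` generate G I \<subseteq> carrier G"
  shows "f a \<in> generate G K"
proof -
  have hom: "f \<in> hom (G\<lparr>carrier := generate G I\<rparr>) G"
    using assms by (auto simp: hom_def)
  interpret f: group_hom "G\<lparr>carrier := generate G I\<rparr>" G f
    using subgroup.subgroup_is_group[OF generate_is_subgroup[OF assms(1)] is_group] hom is_group
    by (simp add: group_hom_def group_hom_axioms_def)
  have K: "subgroup (generate G K) G" by (rule generate_is_subgroup[OF assms(3)])
  show ?thesis
    using assms(5)
  proof (induction rule: generate.induct)
    case one
    then show ?case using f.hom_one K by (simp add: subgroup.one_closed)
  next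
    case (incl h)
    then show ?case using assms(2) by auto
  next
    case (inv h)
    then have "inv (f h) \<in> generate G K"
      using assms(2) K by (auto intro: subgroup.m_inv_closed)
    moreover have "f (inv h) = inv (f h)"
      using f.hom_inv[of h] inv generate.incl[of h I G]
        m_inv_consistent[OF generate_is_subgroup[OF assms(1)]] by simp
    ultimately show ?case by simp
  next
    case (eng h1 h2)
    then show ?case using assms(4) K by (simp add: subgroup.m_closed)
  qed
qed

end

section \<open>Words, length and parity in a Coxeter system\<close>

context coxeter_system
begin

abbreviation "weval \<equiv> word_eval G"
abbreviation "len \<equiv> word_length G S"
abbreviation "W \<equiv> generate G"

lemma S_closed [simp, intro]: "s \<in> S \<Longrightarrow> s \<in> carrier G"
  using S_subset by blast

lemma S_square [simp]: "s \<in> S \<Longrightarrow> s \<otimes> s = \<one>"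
  using pow_ord_eq_1[of s] S_order_two[of s] by (simp add: numeral_2_eq_2)

lemma S_inv [simp]: "s \<in> S \<Longrightarrow> inv s = s"
  by (rule inv_equality) auto

lemma S_cancel [simp]: "s \<in> S \<Longrightarrow> w \<in> carrier G \<Longrightarrow> s \<otimes> (s \<otimes> w) = w"
  by (simp flip: m_assoc)

lemma S_word_closed: "set xs \<subseteq> S \<Longrightarrow> set xs \<subseteq> carrier G"
  using S_subset by blast

lemma weval_closed [simp, intro]: "set xs \<subseteq> S \<Longrightarrow> weval xs \<in> carrier G"
  by (intro word_eval_closed S_word_closed)

lemma weval_append [simp]:
  "set xs \<subseteq> S \<Longrightarrow> set ys \<subseteq> S \<Longrightarrow> weval (xs @ ys) = weval xs \<otimes> weval ys"
  by (intro word_eval_append S_word_closed)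

lemma W_closed: "I \<subseteq> S \<Longrightarrow> a \<in> W I \<Longrightarrow> a \<in> carrier G"
  using generate_incl S_subset by blast

lemma W_subgroup: "I \<subseteq> S \<Longrightarrow> subgroup (W I) G"
  using generate_is_subgroup S_subset by blast

lemma W_mult: "a \<in> W I \<Longrightarrow> b \<in> W I \<Longrightarrow> a \<otimes> b \<in> W I"
  by (rule generate.eng)

lemma W_inv: "I \<subseteq> S \<Longrightarrow> a \<in> W I \<Longrightarrow> inv a \<in> W I"
  by (rule subgroup.m_inv_closed[OF W_subgroup])

lemma weval_in_W: "set xs \<subseteq> I \<Longrightarrow> weval xs \<in> W I"
  by (induction xs) (auto intro: generate.intros)

lemma W_word:
  assumes "I \<subseteq> S" "a \<in> W I"
  obtains xs where "set xs \<subseteq> I" "weval xs = a"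
proof -
  have "\<exists>xs. set xs \<subseteq> I \<and> weval xs = a"
    using assms(2)
  proof (induction rule: generate.induct)
    case one
    show ?case by (rule exI[of _ "[]"]) simp
  next
    case (incl h)
    with assms(1) show ?case by (intro exI[of _ "[h]"]) auto
  next
    case (inv h)
    moreover from this assms(1) have "h \<in> S" by auto
    ultimately show ?case by (intro exI[of _ "[h]"]) auto
  next
    case (eng h1 h2)
    then obtain xs ys where "set xs \<subseteq> I" "weval xs = h1" "set ys \<subseteq> I" "weval ys = h2" by blast
    with assms(1) show ?case by (intro exI[of _ "xs @ ys"]) auto
  qed
  with that show ?thesis by blast
qed

lemma len_eval_le: "set xs \<subseteq> S \<Longrightarrow> len (weval xs) \<le> length xs"
  unfolding word_length_def by (rule Least_le) auto

lemma reduced_word: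
  assumes "w \<in> carrier G"
  obtains xs where "set xs \<subseteq> S" "weval xs = w" "length xs = len w"
proof -
  obtain ys where "set ys \<subseteq> S" "weval ys = w"
    using W_word[of S w] assms S_generates by auto
  then have "\<exists>n. \<exists>xs\<in>lists S. length xs = n \<and> weval xs = w" by auto
  from LeastI_ex[OF this] that show ?thesis
    unfolding word_length_def[symmetric] by auto
qed

text \<open>Each relator has length 2m, so inserting or deleting it keeps the parity. Through
  \<open>S_presents\<close> this makes parity of length a function of the group element.\<close>

lemma coxeter_equiv_even_length:
  "coxeter_equiv G S xs ys \<Longrightarrow> even (length xs) = even (length ys)"
  by (induction rule: coxeter_equiv.induct) (auto simp: length_concat sum_list_replicate)

lemma even_len_eval:
  assumes "set xs \<subseteq> S"
  shows "even (len (weval xs)) = even (length xs)"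
proof -
  obtain ys where "set ys \<subseteq> S" "weval ys = weval xs" "length ys = len (weval xs)"
    using reduced_word[of "weval xs"] assms by blast
  with coxeter_equiv_even_length[OF S_presents[of ys xs]] assms show ?thesis by auto
qed

lemma len_mult_even:
  assumes "s \<in> S" "w \<in> carrier G"
  shows "even (len (s \<otimes> w)) \<longleftrightarrow> odd (len w)"
proof -
  obtain xs where "set xs \<subseteq> S" "weval xs = w" "length xs = len w"
    using reduced_word assms(2) by blast
  with even_len_eval[of "s # xs"] assms(1) show ?thesis by auto
qed

lemma len_mult_le:
  assumes "s \<in> S" "w \<in> carrier G"
  shows "len (s \<otimes> w) \<le> Suc (len w)"
proof -
  obtain xs where "set xs \<subseteq> S" "weval xs = w" "length xs = len w"
    using reduced_word assms(2) by blast
  with len_eval_le[of "s # xs"] assms(1) show ?thesis by auto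
qed

lemma len_mult_cases:
  assumes "s \<in> S" "w \<in> carrier G"
  obtains "len (s \<otimes> w) = Suc (len w)" | "len w = Suc (len (s \<otimes> w))"
proof -
  have "len (s \<otimes> w) \<noteq> len w" using len_mult_even[OF assms] by auto
  moreover have "len w \<le> Suc (len (s \<otimes> w))"
    using len_mult_le[of s "s \<otimes> w"] assms by simp
  ultimately show ?thesis using len_mult_le[OF assms] that by linarith
qed

lemma weval_rev: "set xs \<subseteq> S \<Longrightarrow> weval (rev xs) = inv (weval xs)"
  by (induction xs) (auto simp: inv_mult_group)

lemma len_inv:
  assumes "w \<in> carrier G"
  shows "len (inv w) = len w"
proof -
  have le: "len (inv v) \<le> len v" if "v \<in> carrier G" for v
  proof -
    obtain xs where "set xs \<subseteq> S" "weval xs = v" "length xs = len v"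
      using reduced_word \<open>v \<in> carrier G\<close> by blast
    with len_eval_le[of "rev xs"] weval_rev[of xs] show ?thesis by simp
  qed
  from le[of w] le[of "inv w"] assms show ?thesis by simp
qed

lemma len_eq_0_iff: "w \<in> carrier G \<Longrightarrow> len w = 0 \<longleftrightarrow> w = \<one>"
  using reduced_word[of w] len_eval_le[of "[]"] by force

lemma len_S: "s \<in> S \<Longrightarrow> len s = 1"
  using len_eval_le[of "[s]"] len_mult_even[of s \<one>] len_eq_0_iff[of \<one>]
  by (cases "len s") auto

section \<open>Reflection parity and the exchange condition\<close>

text \<open>The parity of the number of \<open>i\<close> with \<open>t = s\<^sub>1 \<dots> s\<^sub>i \<dots> s\<^sub>1\<close>, for the word \<open>s\<^sub>1 \<dots> s\<^sub>n\<close>.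
  It depends only on the value of the word, which yields the exchange condition.\<close>

fun refl_odd :: "'a list \<Rightarrow> 'a \<Rightarrow> bool" where
  "refl_odd [] t = False"
| "refl_odd (s # xs) t = ((t = s) \<noteq> refl_odd xs (s \<otimes> t \<otimes> s))"

text \<open>A cocycle rule: the reflections contributed by the second word are conjugated by the
  value of the first. It allows a relator to be cut out of the middle of a word.\<close>

lemma refl_odd_append:
  "set xs \<subseteq> S \<Longrightarrow> t \<in> carrier G \<Longrightarrow>
    refl_odd (xs @ ys) t = (refl_odd xs t \<noteq> refl_odd ys (inv (weval xs) \<otimes> t \<otimes> weval xs))"
  by (induction xs arbitrary: t) (auto simp: inv_mult_group m_assoc)

text \<open>Counting from zero, the i-th reflection of the word s t s t ... is
  \<open>(s \<otimes> t) [^] i \<otimes> s\<close>; the sum counts how often r occurs among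
  them.\<close>

lemma refl_odd_alternating:
  assumes "s \<in> S" "t \<in> S" "r \<in> carrier G"
  shows "refl_odd (concat (replicate k [s, t])) r =
    odd (\<Sum>i<2*k. of_bool (r = (s \<otimes> t) [^] i \<otimes> s) :: nat)"
  using assms(3)
proof (induction k arbitrary: r)
  case 0
  then show ?case by simp
next
  case (Suc k)
  let ?r = "t \<otimes> (s \<otimes> r \<otimes> s) \<otimes> t" and ?p = "s \<otimes> t"
  have p: "?p \<in> carrier G" using assms by auto
  \<comment> \<open>Inequality of truth values is addition modulo 2.\<close>
  have xor: "(a \<noteq> (b \<noteq> odd n)) = odd (of_bool a + (of_bool b + n))" for a b and n :: nat
    by auto
  have 1: "s \<otimes> r \<otimes> s = t \<longleftrightarrow> r = s \<otimes> t \<otimes> s"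
    using assms Suc.prems by (auto simp: m_assoc)
  \<comment> \<open>Passing the two leading letters s and t conjugates r, which shifts the exponent
    by two.\<close>
  have 2: "?r = ?p [^] i \<otimes> s \<longleftrightarrow> r = ?p [^] Suc (Suc i) \<otimes> s" for i :: nat
  proof -
    have "?r = ?p [^] i \<otimes> s \<longleftrightarrow> s \<otimes> (t \<otimes> ?r \<otimes> t) \<otimes> s = s \<otimes> (t \<otimes> (?p [^] i \<otimes> s) \<otimes> t) \<otimes> s"
      using assms Suc.prems p by simp
    also have "s \<otimes> (t \<otimes> ?r \<otimes> t) \<otimes> s = r"
      using assms Suc.prems by (simp add: m_assoc)
    also have "s \<otimes> (t \<otimes> (?p [^] i \<otimes> s) \<otimes> t) \<otimes> s = ?p [^] Suc (Suc i) \<otimes> s"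
      using assms nat_pow_Suc2[OF p, of i] p by (simp add: m_assoc)
    finally show ?thesis .
  qed
  have "refl_odd (concat (replicate (Suc k) [s, t])) r =
      ((r = s) \<noteq> ((s \<otimes> r \<otimes> s = t) \<noteq> refl_odd (concat (replicate k [s, t])) ?r))"
    by simp
  also have "refl_odd (concat (replicate k [s, t])) ?r =
      odd (\<Sum>i<2*k. of_bool (r = ?p [^] Suc (Suc i) \<otimes> s) :: nat)"
    using Suc.IH[of ?r] assms Suc.prems by (simp only: 2) simp
  also have "(r = s) = (r = ?p [^] (0::nat) \<otimes> s)"
    using assms by simp
  also have "(s \<otimes> r \<otimes> s = t) = (r = ?p [^] Suc 0 \<otimes> s)"
    using assms by (simp add: 1)
  finally have "refl_odd (concat (replicate (Suc k) [s, t])) r =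
      odd (of_bool (r = ?p [^] (0::nat) \<otimes> s) + (of_bool (r = ?p [^] Suc 0 \<otimes> s) +
        (\<Sum>i<2*k. of_bool (r = ?p [^] Suc (Suc i) \<otimes> s))) :: nat)"
    by (simp only: xor)
  then show ?case
    by (simp only: mult_Suc_right add_2_eq_Suc sum.lessThan_Suc_shift)
qed

text \<open>The exponents run over 2m values, but \<open>s \<otimes> t\<close> has order m, so each
  reflection is met equally often in the two halves. For infinite order m is 0 and the word is
  empty.\<close>

lemma refl_odd_relator:
  assumes "s \<in> S" "t \<in> S" "r \<in> carrier G"
  shows "\<not> refl_odd (concat (replicate (ord (s \<otimes> t)) [s, t])) r"
proof -
  let ?p = "s \<otimes> t" and ?m = "ord (s \<otimes> t)"
  let ?f = "\<lambda>i. of_bool (r = ?p [^] i \<otimes> s) :: nat"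
  have p: "?p \<in> carrier G" using assms by auto
  have "?f (i + ?m) = ?f i" for i
    using p by (simp add: nat_pow_mult[symmetric])
  then have "(\<Sum>i<2 * ?m. ?f i) = 2 * (\<Sum>i<?m. ?f i)"
    using sum.nat_group[of ?f ?m 2] sum.shift_bounds_nat_ivl[of ?f 0 ?m ?m]
    by (simp add: lessThan_atLeast0 mult.commute numeral_2_eq_2)
  then show ?thesis
    using refl_odd_alternating[OF assms] by simp
qed

lemma weval_relator:
  assumes "s \<in> S" "t \<in> S"
  shows "weval (concat (replicate k [s, t])) = (s \<otimes> t) [^] k"
proof (induction k)
  case (Suc k)
  then show ?case using assms nat_pow_Suc2[of "s \<otimes> t" k] by (simp add: m_assoc)
qed simp

text \<open>A relator has value one and contributes no parity, so by the cocycle rule its deletion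
  changes nothing in front of it or behind it.\<close>

lemma refl_odd_coxeter_equiv:
  "coxeter_equiv G S xs ys \<Longrightarrow> r \<in> carrier G \<Longrightarrow> refl_odd xs r = refl_odd ys r"
proof (induction arbitrary: r rule: coxeter_equiv.induct)
  case (delete us vs s t)
  let ?c = "concat (replicate (ord (s \<otimes> t)) [s, t])"
  have c: "set ?c \<subseteq> S" using delete by auto
  have "weval ?c = \<one>"
    using delete by (simp add: weval_relator pow_ord_eq_1)
  with c show ?case
    using delete refl_odd_relator[of s t]
    by (simp add: refl_odd_append[of ?c] refl_odd_append[of us] lists_eq_set)
qed auto

lemma refl_odd_eval:
  assumes "set xs \<subseteq> S" "set ys \<subseteq> S" "weval xs = weval ys" "r \<in> carrier G"
  shows "refl_odd xs r = refl_odd ys r"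
  using refl_odd_coxeter_equiv[OF S_presents[of xs ys]] assms by auto

text \<open>Odd multiplicity forces at least one occurrence of r as the reflection of some letter,
  and multiplying by that reflection deletes the letter.\<close>

lemma refl_odd_delete:
  assumes "set xs \<subseteq> S" "r \<in> carrier G" "refl_odd xs r"
  shows "\<exists>us t vs. xs = us @ t # vs \<and> r \<otimes> weval xs = weval (us @ vs)"
  using assms
proof (induction xs arbitrary: r)
  case (Cons s xs)
  show ?case
  proof (cases "r = s")
    case True
    with Cons.prems show ?thesis by (intro exI[of _ "[]"] exI[of _ s] exI[of _ xs]) auto
  next
    case False
    with Cons.prems have "refl_odd xs (s \<otimes> r \<otimes> s)" by simp
    with Cons obtain us t vs where *: "xs = us @ t # vs" "s \<otimes> r \<otimes> s \<otimes> weval xs = weval (us @ vs)"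
      by (metis S_closed insert_subset list.simps(15) m_closed)
    have "r \<otimes> weval (s # xs) = s \<otimes> (s \<otimes> r \<otimes> s \<otimes> weval xs)"
      using Cons.prems by (simp add: m_assoc)
    with * show ?thesis by (intro exI[of _ "s # us"] exI[of _ t] exI[of _ vs]) simp
  qed
qed simp

text \<open>The word \<open>xs\<close> may be non-reduced. It is compared with
  \<open>s # ys\<close>, where \<open>ys\<close> is a reduced word for the shorter element: s has
  even parity in \<open>ys\<close>, hence odd parity in \<open>s # ys\<close>, hence in
  \<open>xs\<close>.\<close>

theorem exchange:
  assumes "set xs \<subseteq> S" "s \<in> S" "len (s \<otimes> weval xs) < len (weval xs)"
  obtains us t vs where "xs = us @ t # vs" "s \<otimes> weval xs = weval (us @ vs)"
proof -
  obtain ys where ys: "set ys \<subseteq> S" "weval ys = s \<otimes> weval xs" "length ys = len (s \<otimes> weval xs)"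
    using reduced_word[of "s \<otimes> weval xs"] assms by auto
  \<comment> \<open>Otherwise a letter of \<open>ys\<close> could be deleted, giving a word for
    \<open>weval xs\<close> shorter than the strictly shorter element
    \<open>s \<otimes> weval xs\<close>.\<close>
  have "\<not> refl_odd ys s"
  proof
    assume "refl_odd ys s"
    then obtain us t vs where *: "ys = us @ t # vs" "s \<otimes> weval ys = weval (us @ vs)"
      using refl_odd_delete[OF ys(1)] assms by blast
    with ys assms have "len (weval xs) \<le> length (us @ vs)"
      using len_eval_le[of "us @ vs"] by auto
    with * ys(3) assms(3) show False by simp
  qed
  then have "refl_odd (s # ys) s" using assms by simp
  then have "refl_odd xs s"
    using refl_odd_eval[of xs "s # ys" s] assms ys by simp
  with refl_odd_delete[OF assms(1)] assms(2) that show ?thesis by blast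
qed

theorem exchange_right:
  assumes "set xs \<subseteq> S" "s \<in> S" "len (weval xs \<otimes> s) < len (weval xs)"
  obtains us t vs where "xs = us @ t # vs" "weval xs \<otimes> s = weval (us @ vs)"
proof -
  have *: "s \<otimes> weval (rev xs) = inv (weval xs \<otimes> s)"
    using assms by (simp add: weval_rev inv_mult_group)
  have "len (s \<otimes> weval (rev xs)) < len (weval (rev xs))"
    using assms by (simp add: * len_inv) (simp add: weval_rev len_inv)
  then obtain us t vs where e: "rev xs = us @ t # vs" "s \<otimes> weval (rev xs) = weval (us @ vs)"
    using exchange[of "rev xs" s] assms by auto
  from e(1) have xs: "xs = rev vs @ t # rev us"
    by (metis rev_append rev_rev_ident rev.simps(2) append.assoc append_Cons append_Nil)
  have "set (us @ vs) \<subseteq> S" using xs assms(1) by auto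
  then have "weval xs \<otimes> s = weval (rev (us @ vs))"
    using e(2) * assms by (simp only: weval_rev) (metis inv_inv m_closed weval_closed S_closed)
  with xs that show ?thesis by simp
qed

text \<open>Build the word letter by letter from the left. If a new letter lowers the length, the
  exchange condition only deletes a letter, so the alphabet I is never left. Hence lengths on
  \<open>W I\<close> can be measured with respect to S.\<close>

lemma W_reduced_word:
  assumes "I \<subseteq> S" "a \<in> W I"
  obtains xs where "set xs \<subseteq> I" "weval xs = a" "length xs = len a"
proof -
  have "\<exists>ys. set ys \<subseteq> I \<and> weval ys = weval xs \<and> length ys = len (weval xs)" if "set xs \<subseteq> I" for xs
    using that
  proof (induction xs)
    case Nil
    show ?case by (rule exI[of _ "[]"]) (simp add: len_eq_0_iff)
  next
    case (Cons s xs)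
    then obtain ys where ys: "set ys \<subseteq> I" "weval ys = weval xs" "length ys = len (weval xs)" by auto
    have s: "s \<in> I" "s \<in> S" "set xs \<subseteq> S" "set ys \<subseteq> S" using Cons.prems assms(1) ys by auto
    show ?case
    proof (rule len_mult_cases[of s "weval xs"])
      assume "len (s \<otimes> weval xs) = Suc (len (weval xs))"
      with ys s show ?thesis by (intro exI[of _ "s # ys"]) simp
    next
      assume *: "len (weval xs) = Suc (len (s \<otimes> weval xs))"
      then obtain us t vs where "ys = us @ t # vs" "s \<otimes> weval ys = weval (us @ vs)"
        using exchange[of ys s] ys s by auto
      with * ys s show ?thesis by (intro exI[of _ "us @ vs"]) auto
    qed (use s in auto)
  qed
  with W_word[OF assms] that show ?thesis by metis
qed

section \<open>Minimal representatives of cosets of parabolic subgroups\<close>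

lemma min_left_reps_iff:
  "w \<in> min_left_reps G S I \<longleftrightarrow> w \<in> carrier G \<and> (\<forall>a\<in>W I. len w \<le> len (a \<otimes> w))"
  by (auto simp: min_left_reps_def r_coset_def)

lemma min_left_reps_closed: "w \<in> min_left_reps G S I \<Longrightarrow> w \<in> carrier G"
  by (simp add: min_left_reps_iff)

text \<open>Decides in which factor of a concatenation the letter deleted by an exchange
  lies.\<close>

lemma append_eq_append_Cons_cases:
  assumes "xs @ ys = us @ t # vs"
  obtains zs where "xs = us @ t # zs" "vs = zs @ ys"
    | zs where "us = xs @ zs" "ys = zs @ t # vs"
proof -
  from assms obtain zs where "xs = us @ zs \<and> zs @ ys = t # vs \<or> us = xs @ zs \<and> ys = zs @ t # vs"
    by (auto simp: append_eq_append_conv2)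
  with that that(2)[of "[]"] show ?thesis by (cases zs) auto
qed

text \<open>Induction along a reduced word of a. Were a new letter s to lower the length, an
  exchange would delete a letter either from the word of a, against its being reduced, or from the
  word of x, against the minimality of x.\<close>

lemma len_mult_min_left_reps:
  assumes "I \<subseteq> S" "x \<in> min_left_reps G S I" "a \<in> W I"
  shows "len (a \<otimes> x) = len a + len x"
proof -
  have x: "x \<in> carrier G" and x_min: "\<And>a. a \<in> W I \<Longrightarrow> len x \<le> len (a \<otimes> x)"
    using assms(2) by (auto simp: min_left_reps_iff)
  obtain ys where ys: "set ys \<subseteq> S" "weval ys = x" "length ys = len x"
    using reduced_word[OF x] by blast
  have "len (weval xs \<otimes> x) = length xs + len x" if "set xs \<subseteq> I" "len (weval xs) = length xs" for xs
    using that
  proof (induction xs)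
    case Nil
    then show ?case using x by simp
  next
    case (Cons s xs)
    let ?a = "weval xs"
    have s: "s \<in> I" "s \<in> S" "set xs \<subseteq> S" "set xs \<subseteq> I" using Cons.prems assms(1) by auto
    have a: "?a \<in> W I" "?a \<in> carrier G" using s weval_in_W by auto
    have "length xs \<le> len ?a"
      using Cons.prems(2) len_mult_le[of s ?a] s by simp
    with len_eval_le s have "len ?a = length xs" by (simp add: le_antisym)
    with Cons.IH s have IH: "len (?a \<otimes> x) = length xs + len x" by simp
    show ?case
    proof (rule len_mult_cases[of s "?a \<otimes> x"])
      assume "len (s \<otimes> (?a \<otimes> x)) = Suc (len (?a \<otimes> x))"
      with IH s x a show ?thesis by (simp add: m_assoc)
    next
      assume "len (?a \<otimes> x) = Suc (len (s \<otimes> (?a \<otimes> x)))"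
      then obtain us t vs where e: "xs @ ys = us @ t # vs" "s \<otimes> weval (xs @ ys) = weval (us @ vs)"
        using exchange[of "xs @ ys" s] ys s by auto
      from e(1) show ?thesis
      proof (cases rule: append_eq_append_Cons_cases)
        case (1 zs)
        with s have zs: "set (us @ zs) \<subseteq> S" by auto
        with e(2) 1 ys s x a have "s \<otimes> ?a \<otimes> x = weval (us @ zs) \<otimes> x"
          by (simp add: m_assoc)
        with s x a zs have "s \<otimes> ?a = weval (us @ zs)"
            by (simp del: weval_append set_append)
        with len_eval_le[OF zs] Cons.prems(2) 1 show ?thesis by simp
      next
        case (2 zs)
        with ys have zs: "set (zs @ vs) \<subseteq> S" by auto
        with e(2) 2 ys s x a have "s \<otimes> (?a \<otimes> x) = ?a \<otimes> weval (zs @ vs)"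
          by (simp add: m_assoc)
        then have "weval (zs @ vs) = inv ?a \<otimes> (s \<otimes> (?a \<otimes> x))"
          using a zs by (metis inv_mult_cancel weval_closed)
        \<comment> \<open>The shortened word of x represents
          \<open>inv ?a \<otimes> s \<otimes> ?a\<close> times x, an element of the same coset of
          \<open>W I\<close>.\<close>
        also have "\<dots> = (inv ?a \<otimes> (s \<otimes> ?a)) \<otimes> x"
          using a s x by (simp add: m_assoc)
        finally have "len x \<le> len (weval (zs @ vs))"
          using x_min[OF W_mult[OF W_inv[OF assms(1) a(1)] W_mult[OF generate.incl[OF s(1)] a(1)]]]
          by simp
        with len_eval_le[OF zs] 2 ys show ?thesis by simp
      qed
    qed (use s a x in auto)
  qed
  moreover obtain xs where "set xs \<subseteq> I" "weval xs = a" "length xs = len a"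
    using W_reduced_word[OF assms(1,3)] .
  ultimately show ?thesis by auto
qed

text \<open>Length additivity in both directions gives len x = 2 len a + len x.\<close>

lemma min_left_reps_unique:
  assumes "I \<subseteq> S" "x \<in> min_left_reps G S I" "a \<in> W I" "a \<otimes> x \<in> min_left_reps G S I"
  shows "a = \<one>"
proof -
  have "len (inv a \<otimes> (a \<otimes> x)) = len (inv a) + len (a \<otimes> x)"
    using len_mult_min_left_reps[OF assms(1,4)] W_inv assms by blast
  moreover have "len (a \<otimes> x) = len a + len x"
    using len_mult_min_left_reps assms by blast
  ultimately show ?thesis
    using W_closed[OF assms(1,3)] min_left_reps_closed[OF assms(2)] len_eq_0_iff[of a] by simp
qed

lemma min_left_reps_exists:
  assumes "I \<subseteq> S" "w \<in> carrier G"
  obtains a x where "a \<in> W I" "x \<in> min_left_reps G S I" "w = a \<otimes> x"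
proof -
  obtain b where b: "b \<in> W I" "\<And>a. a \<in> W I \<Longrightarrow> len (b \<otimes> w) \<le> len (a \<otimes> w)"
    using arg_min_nat_lemma[of "\<lambda>a. a \<in> W I" \<one> "\<lambda>a. len (a \<otimes> w)"] generate.one by blast
  have bc: "b \<in> carrier G" using W_closed assms b by blast
  have "len (b \<otimes> w) \<le> len (a \<otimes> (b \<otimes> w))" if "a \<in> W I" for a
    using b(2)[OF W_mult[OF that b(1)]] W_closed[OF assms(1) that] bc assms(2) by (simp add: m_assoc)
  then have "b \<otimes> w \<in> min_left_reps G S I"
    using bc assms by (simp add: min_left_reps_iff)
  moreover have "w = inv b \<otimes> (b \<otimes> w)" using bc assms by simp
  ultimately show ?thesis using that W_inv assms b by blast
qed

text \<open>Minimality can be tested on simple reflections: if w = a x with x minimal and a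
  nontrivial, the first letter of a reduced word of a shortens w.\<close>

lemma min_left_repsI:
  assumes "I \<subseteq> S" "w \<in> carrier G" "\<And>s. s \<in> I \<Longrightarrow> len w \<le> len (s \<otimes> w)"
  shows "w \<in> min_left_reps G S I"
proof -
  obtain a x where ax: "a \<in> W I" "x \<in> min_left_reps G S I" "w = a \<otimes> x"
    using min_left_reps_exists assms by blast
  have x: "x \<in> carrier G" using ax min_left_reps_closed by blast
  obtain xs where xs: "set xs \<subseteq> I" "weval xs = a" "length xs = len a"
    using W_reduced_word assms ax by blast
  show ?thesis
  proof (cases xs)
    case Nil
    with xs have "a = \<one>" by simp
    with ax x show ?thesis by simp
  next
    case (Cons s ys)
    have s: "s \<in> I" "s \<in> S" "set ys \<subseteq> I" "set ys \<subseteq> S" using xs Cons assms(1) by auto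
    have "s \<otimes> w = weval ys \<otimes> x" using ax xs Cons s x by (auto simp: m_assoc)
    then have "len (s \<otimes> w) = len (weval ys) + len x"
      using len_mult_min_left_reps assms ax weval_in_W s by metis
    also have "\<dots> < len w"
      using len_eval_le[OF s(4)] xs Cons len_mult_min_left_reps[OF assms(1) ax(2,1)] ax(3) by simp
    finally show ?thesis using assms(3)[OF s(1)] by simp
  qed
qed

text \<open>If \<open>x \<otimes> t\<close> is not minimal, some s in I shortens it, and an exchange
  deletes a letter of a reduced word of x followed by t. Deleting inside x would make s x shorter
  than x, so the deleted letter is t and s x t = x.\<close>

lemma deodhar:
  assumes "I \<subseteq> S" "x \<in> min_left_reps G S I" "t \<in> S"
  shows "x \<otimes> t \<in> min_left_reps G S I \<or> (\<exists>s\<in>I. x \<otimes> t = s \<otimes> x)"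
proof (unfold disj_imp, rule impI)
  have x: "x \<in> carrier G" using assms min_left_reps_closed by blast
  assume "x \<otimes> t \<notin> min_left_reps G S I"
  then obtain s where s: "s \<in> I" "len (s \<otimes> (x \<otimes> t)) < len (x \<otimes> t)"
    using min_left_repsI[OF assms(1), of "x \<otimes> t"] x assms by (meson S_closed leI m_closed)
  then have sS: "s \<in> S" using assms by auto
  obtain xs where xs: "set xs \<subseteq> S" "weval xs = x" "length xs = len x"
    using reduced_word[OF x] by blast
  obtain us r vs where e: "xs @ [t] = us @ r # vs" "s \<otimes> weval (xs @ [t]) = weval (us @ vs)"
    using exchange[of "xs @ [t]" s] s sS xs assms by auto
  from e(1) show "\<exists>s\<in>I. x \<otimes> t = s \<otimes> x"
  proof (cases rule: append_eq_append_Cons_cases)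
    case (1 zs)
    with xs have zs: "set (us @ zs) \<subseteq> S" by auto
    have "s \<otimes> x \<otimes> t = s \<otimes> weval (xs @ [t])"
      using xs assms sS x by (simp add: m_assoc)
    also have "\<dots> = weval ((us @ zs) @ [t])"
      using e(2) 1(2) by (simp only: append_assoc)
    also have "\<dots> = weval (us @ zs) \<otimes> t"
      using zs assms by (simp del: append_assoc)
    finally have "s \<otimes> x \<otimes> t = weval (us @ zs) \<otimes> t" .
    with zs assms x sS have "s \<otimes> x = weval (us @ zs)"
      by (metis r_cancel m_closed S_closed weval_closed)
    with len_eval_le[OF zs] 1 xs have "len (s \<otimes> x) < len x" by simp
    with assms s show ?thesis by (auto simp: min_left_reps_iff generate.incl leD)
  next
    case (2 zs)
    then have "us = xs" "vs = []" by (auto simp: Cons_eq_append_conv)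
    with e(2) xs assms x have "s \<otimes> (x \<otimes> t) = x" by simp
    with sS x assms have "x \<otimes> t = s \<otimes> x" by (metis S_cancel S_closed m_closed)
    with s show ?thesis by blast
  qed
qed

section \<open>Double cosets and the lemma of Kilmoyer\<close>

definition double_min :: "'a set \<Rightarrow> 'a set \<Rightarrow> 'a set" where
  "double_min I J = {y \<in> carrier G. \<forall>a\<in>W I. \<forall>b\<in>W J. len y \<le> len (a \<otimes> y \<otimes> b)}"

lemma double_min_exists:
  assumes "I \<subseteq> S" "J \<subseteq> S" "w \<in> carrier G"
  obtains a y b where "a \<in> W I" "y \<in> double_min I J" "b \<in> W J" "w = a \<otimes> y \<otimes> b"
proof -
  define f where "f = (\<lambda>(a, b). len (a \<otimes> w \<otimes> b))"
  obtain a b where ab: "a \<in> W I" "b \<in> W J"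
      and m: "\<And>c d. c \<in> W I \<Longrightarrow> d \<in> W J \<Longrightarrow> len (a \<otimes> w \<otimes> b) \<le> len (c \<otimes> w \<otimes> d)"
    using arg_min_nat_lemma[of "\<lambda>p. p \<in> W I \<times> W J" "(\<one>, \<one>)" f]
    by (auto simp: generate.one f_def)
  note c = W_closed[OF assms(1)] W_closed[OF assms(2)] assms(3)
  have "a \<otimes> w \<otimes> b \<in> double_min I J"
  proof -
    have "len (a \<otimes> w \<otimes> b) \<le> len (c \<otimes> (a \<otimes> w \<otimes> b) \<otimes> d)" if "c \<in> W I" "d \<in> W J" for c d
      using m[OF W_mult[OF that(1) ab(1)] W_mult[OF ab(2) that(2)]] that ab c
      by (simp add: m_assoc)
    then show ?thesis using ab c by (simp add: double_min_def)
  qed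
  moreover have "w = inv a \<otimes> (a \<otimes> w \<otimes> b) \<otimes> inv b"
    using ab c by (simp add: m_assoc)
  ultimately show ?thesis using that ab W_inv assms by metis
qed

lemma double_min_left:
  assumes "I \<subseteq> S" "y \<in> double_min I J"
  shows "y \<in> min_left_reps G S I"
  using assms W_closed[OF assms(1)] generate.one[of G J]
  by (force simp: double_min_def min_left_reps_iff)

text \<open>The inverse of y is minimal in its coset of \<open>W J\<close>, so the additivity of
  lengths for left cosets applies after inversion.\<close>

lemma double_min_len_right:
  assumes "J \<subseteq> S" "y \<in> double_min I J" "b \<in> W J"
  shows "len (y \<otimes> b) = len y + len b"
proof -
  have y: "y \<in> carrier G" using assms by (simp add: double_min_def)
  have b: "b \<in> carrier G" using assms W_closed by blast
  have "len (inv y) \<le> len (c \<otimes> inv y)" if "c \<in> W J" for c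
  proof -
    have c: "c \<in> carrier G" using that assms W_closed by blast
    have "len y \<le> len (\<one> \<otimes> y \<otimes> inv c)"
      using assms that W_inv generate.one[of G I] unfolding double_min_def by blast
    also have "\<dots> = len (inv (c \<otimes> inv y))" using y c by (simp add: inv_mult_group)
    finally show ?thesis using y c by (simp add: len_inv)
  qed
  then have "inv y \<in> min_left_reps G S J" using y by (simp add: min_left_reps_iff)
  then have "len (inv b \<otimes> inv y) = len (inv b) + len (inv y)"
    using len_mult_min_left_reps assms W_inv by blast
  then show ?thesis using y b by (simp add: len_inv flip: inv_mult_group)
qed

text \<open>This is the set \<open>I'\<close> of the overview.\<close>

abbreviation conj_part :: "'a \<Rightarrow> 'a set \<Rightarrow> 'a set \<Rightarrow> 'a set" where
  "conj_part y I J \<equiv> {t \<in> J. y \<otimes> t \<otimes> inv y \<in> I}"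

lemma W_conj_part_conj:
  assumes "I \<subseteq> S" "J \<subseteq> S" "y \<in> carrier G" "v \<in> W (conj_part y I J)"
  shows "y \<otimes> v \<otimes> inv y \<in> W I"
proof -
  have sub: "conj_part y I J \<subseteq> S" using assms(2) by auto
  note closed = W_closed[OF sub]
  have "y \<otimes> (a \<otimes> b) \<otimes> inv y = (y \<otimes> a \<otimes> inv y) \<otimes> (y \<otimes> b \<otimes> inv y)"
    if "a \<in> W (conj_part y I J)" "b \<in> W (conj_part y I J)" for a b
    using closed[OF that(1)] closed[OF that(2)] assms(3) by (simp add: m_assoc)
  then show ?thesis
    using assms sub S_subset closed
    by (intro generate_image_subset[where f = "\<lambda>v. y \<otimes> v \<otimes> inv y" and I = "conj_part y I J"])
       (auto intro: generate.incl)
qed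

text \<open>The nontrivial inclusion of Kilmoyer's lemma. Letters of a reduced word of v are
  stripped from the right; each is shown to be conjugated by y into I, and what remains satisfies
  the same hypotheses.\<close>

lemma W_conj_partI:
  assumes "I \<subseteq> S" "J \<subseteq> S" "y \<in> double_min I J" "v \<in> W J" "y \<otimes> v \<otimes> inv y \<in> W I"
  shows "v \<in> W (conj_part y I J)"
proof -
  have y: "y \<in> carrier G" using assms by (simp add: double_min_def)
  have yI: "y \<in> min_left_reps G S I" using double_min_left assms by blast
  obtain ys where ys: "set ys \<subseteq> S" "weval ys = y" "length ys = len y"
    using reduced_word[OF y] by blast
  have "weval xs \<in> W (conj_part y I J)"
    if "set xs \<subseteq> J" "len (weval xs) = length xs" "y \<otimes> weval xs \<otimes> inv y \<in> W I" for xs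
    using that
  proof (induction xs rule: rev_induct)
    case Nil
    show ?case by (simp add: generate.one)
  next
    case (snoc t xs)
    have t: "t \<in> J" "t \<in> S" "set xs \<subseteq> J" "set xs \<subseteq> S" using snoc.prems assms(2) by auto
    let ?v = "weval (xs @ [t])"
    have vc: "?v \<in> carrier G" "weval xs \<in> carrier G" using t by auto
    have v_eq: "?v = weval xs \<otimes> t" using t by simp
    define a where "a = y \<otimes> ?v \<otimes> inv y"
    have a: "a \<in> W I" "y \<otimes> ?v = a \<otimes> y"
      using snoc.prems(3) vc y by (simp_all add: a_def m_assoc del: weval_append)
    have ac: "a \<in> carrier G" using a assms W_closed by blast
    obtain as where as: "set as \<subseteq> I" "weval as = a" "length as = len a"
      using W_reduced_word[OF assms(1) a(1)] by blast
    have asS: "set as \<subseteq> S" using as assms by auto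
    have vt: "?v \<otimes> t = weval xs" using t vc by (simp add: m_assoc)
    \<comment> \<open>Lengths add along \<open>y \<otimes> ?v\<close>, so removing the last letter t
      lowers the length; this permits an exchange in the word \<open>as @ ys\<close> of the same
      element.\<close>
    have "len (y \<otimes> ?v \<otimes> t) < len (y \<otimes> ?v)"
    proof -
      have "len (y \<otimes> ?v \<otimes> t) = len (y \<otimes> weval xs)"
        using y vc t vt by (simp add: m_assoc del: weval_append)
      also have "\<dots> = len y + len (weval xs)"
        using double_min_len_right[OF assms(2,3) weval_in_W[OF t(3)]] .
      also have "\<dots> < len y + len ?v"
        using snoc.prems(2) len_eval_le[OF t(4)] by simp
      also have "\<dots> = len (y \<otimes> ?v)"
        using double_min_len_right[OF assms(2,3) weval_in_W[OF snoc.prems(1)], symmetric] .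
      finally show ?thesis .
    qed
    then have "len (weval (as @ ys) \<otimes> t) < len (weval (as @ ys))"
      using a as asS ys by simp
    then obtain us r vs where e: "as @ ys = us @ r # vs" "weval (as @ ys) \<otimes> t = weval (us @ vs)"
      using exchange_right[of "as @ ys" t] asS ys t by auto
    have "\<exists>c \<in> W I. a \<otimes> y \<otimes> t = c \<otimes> y"
      using e(1)
    proof (cases rule: append_eq_append_Cons_cases)
      case (1 zs)
      then have "set (us @ zs) \<subseteq> I" using as by auto
      moreover from this have "a \<otimes> y \<otimes> t = weval (us @ zs) \<otimes> y"
        using e(2) 1 as asS ys assms(1) y by (auto simp: m_assoc)
      ultimately show ?thesis using weval_in_W by blast
    next
      \<comment> \<open>A deletion inside y would make \<open>y \<otimes> t\<close> shorter than y,
        whereas its length is one more than that of y.\<close>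
      case (2 zs)
      then have zs: "set (zs @ vs) \<subseteq> S" using ys by auto
      have "a \<otimes> (y \<otimes> t) = a \<otimes> weval (zs @ vs)"
        using e(2) 2 as asS ys zs y ac t by (simp add: m_assoc)
      then have "y \<otimes> t = weval (zs @ vs)"
        using zs y ac t by (simp del: weval_append set_append)
      moreover have "len (y \<otimes> t) = len y + len t"
        using double_min_len_right[OF assms(2,3) generate.incl[OF t(1)]] .
      ultimately show ?thesis using len_eval_le[OF zs] ys(3) 2 by simp
    qed
    then obtain c where c: "c \<in> W I" "a \<otimes> y \<otimes> t = c \<otimes> y" by blast
    have cc: "c \<in> carrier G" using c assms W_closed by blast
    define r where "r = inv a \<otimes> c"
    have r: "r \<in> W I" "r \<in> carrier G" using W_mult W_inv a c cc ac assms by (auto simp: r_def)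
    have "y \<otimes> t = inv a \<otimes> (a \<otimes> y \<otimes> t)" using ac y t by (simp add: m_assoc)
    then have yt: "y \<otimes> t = r \<otimes> y" using c ac cc y by (simp add: r_def m_assoc)
    \<comment> \<open>Both lengths add in \<open>y \<otimes> t = r \<otimes> y\<close>, so r is as
      long as t and hence a single letter of I.\<close>
    have "len r = 1"
      using len_mult_min_left_reps[OF assms(1) yI r(1)] yt len_S[OF t(2)]
        double_min_len_right[OF assms(2,3) generate.incl[OF t(1)]] by simp
    then have "r \<in> I"
    proof -
      obtain rs where rs: "set rs \<subseteq> I" "weval rs = r" "length rs = len r"
        using W_reduced_word[OF assms(1) r(1)] by blast
      with \<open>len r = 1\<close> obtain s where "rs = [s]" by (auto simp: length_Suc_conv)
      with rs assms(1) show ?thesis by auto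
    qed
    moreover have "y \<otimes> t \<otimes> inv y = r" using yt y r by (simp add: m_assoc)
    ultimately have tI: "t \<in> conj_part y I J" using t by simp
    have "weval xs \<in> W (conj_part y I J)"
    proof (rule snoc.IH)
      show "set xs \<subseteq> J" by fact
      have "len ?v \<le> len (weval xs) + 1"
      proof -
        have "len ?v = len (t \<otimes> inv (weval xs))"
          using vc t len_inv[of ?v] by (simp add: inv_mult_group)
        also have "\<dots> \<le> Suc (len (weval xs))"
          using len_mult_le[of t "inv (weval xs)"] t vc by (simp add: len_inv)
        finally show ?thesis by simp
      qed
      then show "len (weval xs) = length xs"
        using snoc.prems(2) len_eval_le[OF t(4)] by simp
      have "y \<otimes> weval xs = y \<otimes> ?v \<otimes> t"
        using y vc t by (simp add: vt m_assoc del: weval_append)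
      also have "\<dots> = c \<otimes> y" by (simp only: a(2) c(2))
      finally have "y \<otimes> weval xs = c \<otimes> y" .
      then have "y \<otimes> weval xs \<otimes> inv y = c" using y cc by (simp add: m_assoc)
      then show "y \<otimes> weval xs \<otimes> inv y \<in> W I" using c by simp
    qed
    then show ?case using v_eq tI by (simp add: W_mult generate.incl)
  qed
  moreover obtain xs where "set xs \<subseteq> J" "weval xs = v" "length xs = len v"
    using W_reduced_word[OF assms(2,4)] .
  ultimately show ?thesis using assms(5) by auto
qed

text \<open>Append the letters of v one by one. By \<open>deodhar\<close> each letter either
  prolongs u or crosses \<open>y \<otimes> u\<close> and becomes a letter of I absorbed by
  a.\<close>

lemma double_min_factor:
  assumes "I \<subseteq> S" "J \<subseteq> S" "y \<in> double_min I J" "v \<in> W J"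
  obtains a u where "a \<in> W I" "u \<in> W J" "y \<otimes> u \<in> min_left_reps G S I" "y \<otimes> v = a \<otimes> (y \<otimes> u)"
proof -
  have y: "y \<in> carrier G" using assms by (simp add: double_min_def)
  have yI: "y \<in> min_left_reps G S I" using double_min_left assms by blast
  note c = W_closed[OF assms(1)] W_closed[OF assms(2)] y
  have "\<exists>a\<in>W I. \<exists>u\<in>W J. y \<otimes> u \<in> min_left_reps G S I \<and> y \<otimes> weval xs = a \<otimes> (y \<otimes> u)"
    if "set xs \<subseteq> J" for xs
    using that
  proof (induction xs rule: rev_induct)
    case Nil
    show ?case
      using y yI by (intro bexI[of _ \<one>] conjI) (simp_all add: generate.one)
  next
    case (snoc t xs)
    then obtain a u where au: "a \<in> W I" "u \<in> W J" "y \<otimes> u \<in> min_left_reps G S I"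
        "y \<otimes> weval xs = a \<otimes> (y \<otimes> u)" by auto
    have t: "t \<in> J" "t \<in> S" "set xs \<subseteq> J" "set xs \<subseteq> S" using snoc.prems assms(2) by auto
    have "y \<otimes> weval (xs @ [t]) = y \<otimes> weval xs \<otimes> t" using t y by (simp add: m_assoc)
    then have e: "y \<otimes> weval (xs @ [t]) = a \<otimes> (y \<otimes> u \<otimes> t)"
      using au t c by (simp add: m_assoc)
    show ?case
      using deodhar[OF assms(1) au(3) t(2)]
    proof (elim disjE bexE)
      assume "y \<otimes> u \<otimes> t \<in> min_left_reps G S I"
      with e au c t show ?thesis
        by (intro bexI[of _ a] bexI[of _ "u \<otimes> t"]) (auto simp: m_assoc intro: W_mult generate.incl)
    next
      fix s assume s: "s \<in> I" "y \<otimes> u \<otimes> t = s \<otimes> (y \<otimes> u)"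
      with e au c assms(1) have "y \<otimes> weval (xs @ [t]) = (a \<otimes> s) \<otimes> (y \<otimes> u)"
        by (simp add: m_assoc subset_iff)
      with s au show ?thesis
        by (intro bexI[of _ "a \<otimes> s"] bexI[of _ u]) (auto intro: W_mult generate.incl)
    qed
  qed
  moreover obtain xs where "set xs \<subseteq> J" "weval xs = v"
    using W_word[OF assms(2,4)] .
  ultimately show ?thesis using that by blast
qed

text \<open>A reflection s in \<open>conj_part y I J\<close> crosses y and becomes an element of I,
  so minimality of \<open>y \<otimes> u\<close> compares it with
  \<open>y \<otimes> (s \<otimes> u)\<close>; the summand len y then cancels.\<close>

lemma min_left_reps_conj_part:
  assumes "I \<subseteq> S" "J \<subseteq> S" "y \<in> double_min I J" "u \<in> W J" "y \<otimes> u \<in> min_left_reps G S I"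
  shows "u \<in> min_left_reps G S (conj_part y I J)"
proof (rule min_left_repsI)
  have y: "y \<in> carrier G" using assms by (simp add: double_min_def)
  have u: "u \<in> carrier G" using W_closed assms by blast
  then show "u \<in> carrier G" .
  show "conj_part y I J \<subseteq> S" using assms by auto
  fix s assume s: "s \<in> conj_part y I J"
  then have sc: "s \<in> carrier G" "s \<in> W J" using assms generate.incl by auto
  have "len y + len u = len (y \<otimes> u)"
    using double_min_len_right assms by simp
  also have "\<dots> \<le> len ((y \<otimes> s \<otimes> inv y) \<otimes> (y \<otimes> u))"
    using assms(5) s by (auto simp: min_left_reps_iff intro: generate.incl)
  also have "(y \<otimes> s \<otimes> inv y) \<otimes> (y \<otimes> u) = y \<otimes> (s \<otimes> u)"
    using y u sc by (simp add: m_assoc)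
  also have "len \<dots> = len y + len (s \<otimes> u)"
    using double_min_len_right[OF assms(2,3) W_mult[OF sc(2) assms(4)]] .
  finally show "len u \<le> len (s \<otimes> u)" by simp
qed

text \<open>Factor y u = a (y v) with y v minimal. By Kilmoyer's lemma u and v lie in the same coset
  of \<open>W (conj_part y I J)\<close>, and both are minimal there, so u = v.\<close>

lemma double_min_mult_min_left_reps:
  assumes "I \<subseteq> S" "J \<subseteq> S" "y \<in> double_min I J" "u \<in> W J"
    and "u \<in> min_left_reps G S (conj_part y I J)"
  shows "y \<otimes> u \<in> min_left_reps G S I"
proof -
  have y: "y \<in> carrier G" using assms by (simp add: double_min_def)
  obtain a v where av: "a \<in> W I" "v \<in> W J" "y \<otimes> v \<in> min_left_reps G S I" "y \<otimes> u = a \<otimes> (y \<otimes> v)"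
    using double_min_factor[OF assms(1-4)] .
  have c: "a \<in> carrier G" "u \<in> carrier G" "v \<in> carrier G"
    using av(1,2) assms(4) W_closed[OF assms(1)] W_closed[OF assms(2)] by auto
  have "y \<otimes> (u \<otimes> inv v) \<otimes> inv y = (y \<otimes> u) \<otimes> inv v \<otimes> inv y"
    using c y by (simp add: m_assoc)
  also have "\<dots> = a" using c y by (simp add: av(4) m_assoc)
  finally have "u \<otimes> inv v \<in> W (conj_part y I J)"
    using W_conj_partI[OF assms(1-3) W_mult[OF assms(4) W_inv[OF assms(2) av(2)]]] av(1) by simp
  moreover have "(u \<otimes> inv v) \<otimes> v = u" using c by (simp add: m_assoc)
  moreover have "v \<in> min_left_reps G S (conj_part y I J)"
    using min_left_reps_conj_part[OF assms(1-3) av(2,3)] .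
  moreover have "conj_part y I J \<subseteq> S" using assms by auto
  ultimately have "u \<otimes> inv v = \<one>"
    using min_left_reps_unique[of "conj_part y I J" v "u \<otimes> inv v"] assms(5) by simp
  with c have "u = v" using \<open>(u \<otimes> inv v) \<otimes> v = u\<close> by simp
  with av show ?thesis by simp
qed

text \<open>Surjectivity of the map \<open>u \<mapsto> y u\<close> of the overview:
  \<open>double_min_factor\<close> gives a minimal y u in the coset of x, and minimal
  representatives are unique.\<close>

lemma min_left_reps_double_coset:
  assumes "I \<subseteq> S" "J \<subseteq> S" "y \<in> double_min I J"
    and "x \<in> min_left_reps G S I" "a \<in> W I" "b \<in> W J" "x = a \<otimes> y \<otimes> b"
  obtains u where "u \<in> W J" "u \<in> min_left_reps G S (conj_part y I J)" "x = y \<otimes> u"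
proof -
  have y: "y \<in> carrier G" using assms by (simp add: double_min_def)
  obtain c u where cu: "c \<in> W I" "u \<in> W J" "y \<otimes> u \<in> min_left_reps G S I" "y \<otimes> b = c \<otimes> (y \<otimes> u)"
    using double_min_factor[OF assms(1-3,6)] .
  note cl = W_closed[OF assms(1)] W_closed[OF assms(2)] y
  have x: "x = (a \<otimes> c) \<otimes> (y \<otimes> u)"
    using assms(5-7) cu cl by (simp add: m_assoc)
  then have "a \<otimes> c = \<one>"
    using min_left_reps_unique[OF assms(1) cu(3) W_mult[OF assms(5) cu(1)]] assms(4) by simp
  with x cu cl have "x = y \<otimes> u" by simp
  with cu(2) min_left_reps_conj_part[OF assms(1-3) cu(2,3)] that show ?thesis by blast
qed

section \<open>Zip data and their reduction along a double coset\<close>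

lemma zip_stab_double_min:
  assumes "I \<subseteq> S" "J \<subseteq> S" "\<psi> ` W I \<subseteq> W J" "y \<in> double_min I J" "u \<in> W J"
  shows "zip_stab G I \<psi> (y \<otimes> u) =
    zip_stab G (conj_part y I J) (\<lambda>v. \<psi> (y \<otimes> v \<otimes> inv y)) u"
proof -
  let ?I = "conj_part y I J" and ?\<psi> = "\<lambda>v. \<psi> (y \<otimes> v \<otimes> inv y)"
  have y: "y \<in> carrier G" using assms by (simp add: double_min_def)
  have u: "u \<in> carrier G" using W_closed assms by blast
  have "?I \<subseteq> S" using assms(2) by auto
  then have WIc': "W ?I \<subseteq> carrier G" and WIc: "W I \<subseteq> carrier G"
    using W_closed assms(1) by (auto intro!: subsetI)
  \<comment> \<open>Both stabilizers are generated by the same family of subgroups E. Conjugation by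
    y u splits into conjugation by u and then by y.\<close>
  have iff: "E \<subseteq> conj_set G (inv (y \<otimes> u)) (W I) \<and> \<psi> ` conj_set G (y \<otimes> u) E = E \<longleftrightarrow>
      E \<subseteq> conj_set G (inv u) (W ?I) \<and> ?\<psi> ` conj_set G u E = E"
    if E: "subgroup E G" for E
  proof -
    have Ec: "E \<subseteq> carrier G" using E by (rule subgroup.subset)
    let ?F = "conj_set G u E"
    have 1: "E \<subseteq> conj_set G (inv (y \<otimes> u)) (W I) \<longleftrightarrow> conj_set G y ?F \<subseteq> W I"
      using subset_conj_set_inv_iff[OF m_closed[OF y u] Ec WIc]
      by (simp only: conj_set_mult[OF y u Ec])
    have 2: "E \<subseteq> conj_set G (inv u) (W ?I) \<longleftrightarrow> ?F \<subseteq> W ?I"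
      by (rule subset_conj_set_inv_iff[OF u Ec WIc'])
    have 3: "\<psi> ` conj_set G (y \<otimes> u) E = ?\<psi> ` ?F"
      using conj_set_mult[OF y u Ec] by (simp add: conj_set_def[of G y] image_image)
    have "?F \<subseteq> W ?I" if "conj_set G y ?F \<subseteq> W I" "?\<psi> ` ?F = E"
    proof
      fix f assume f: "f \<in> ?F"
      have yF: "y \<otimes> g \<otimes> inv y \<in> W I" if "g \<in> ?F" for g
        using that \<open>conj_set G y ?F \<subseteq> W I\<close> by (auto simp: conj_set_def[of G y])
      \<comment> \<open>Since E is itself an image under \<psi>, it lies in \<open>W J\<close>, and
        so does its conjugate by u. This is the membership that Kilmoyer's lemma requires.\<close>
      then have "E \<subseteq> W J" using that(2) assms(3) by blast
      with f obtain e where "e \<in> W J" "f = u \<otimes> e \<otimes> inv u" by (auto simp: conj_set_def)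
      then have "f \<in> W J" using assms(2,5) by (simp add: W_mult W_inv)
      then show "f \<in> W ?I" using yF[OF f] by (rule W_conj_partI[OF assms(1,2,4)])
    qed
    moreover have "conj_set G y ?F \<subseteq> W I" if "?F \<subseteq> W ?I"
      using that W_conj_part_conj[OF assms(1,2) y] by (auto simp: conj_set_def[of G y])
    ultimately show ?thesis unfolding 1 2 3 by blast
  qed
  show ?thesis
    unfolding zip_stab_def by (simp only: iff cong: conj_cong)
qed

text \<open>The ambient group is \<open>W K\<close> with varying \<open>K \<subseteq> S\<close>, but lengths, minimal representatives and
  \<open>zip_equiv\<close> are always taken in \<open>G\<close>; so no parabolic subgroup has to be shown to be a Coxeter
  system.\<close>
definition zip_datum :: "'a set \<Rightarrow> 'a set \<Rightarrow> ('a \<Rightarrow> 'a) \<Rightarrow> bool" where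
  "zip_datum K I \<psi> \<longleftrightarrow> K \<subseteq> S \<and> finite I \<and> I \<subseteq> K \<and> \<psi> ` I \<subseteq> K \<and> inj_on \<psi> I \<and>
    \<psi> ` W I \<subseteq> carrier G \<and> (\<forall>a\<in>W I. \<forall>b\<in>W I. \<psi> (a \<otimes> b) = \<psi> a \<otimes> \<psi> b)"

lemma zip_datumD:
  assumes "zip_datum K I \<psi>"
  shows "K \<subseteq> S" "finite I" "I \<subseteq> K" "\<psi> ` I \<subseteq> K" "inj_on \<psi> I" "\<psi> ` W I \<subseteq> carrier G"
    and "a \<in> W I \<Longrightarrow> b \<in> W I \<Longrightarrow> \<psi> (a \<otimes> b) = \<psi> a \<otimes> \<psi> b"
    and "I \<subseteq> S" "\<psi> ` I \<subseteq> S"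
  using assms unfolding zip_datum_def by blast+

lemma zip_datum_image:
  assumes "zip_datum K I \<psi>" "a \<in> W I"
  shows "\<psi> a \<in> W (\<psi> ` I)"
proof (rule generate_image_subset[of I \<psi>])
  note D = zip_datumD[OF assms(1)]
  show "I \<subseteq> carrier G" "\<psi> ` I \<subseteq> carrier G" using D(8,9) S_subset by blast+
  show "\<psi> ` I \<subseteq> W (\<psi> ` I)" by (auto intro: generate.incl)
  show "\<psi> ` W I \<subseteq> carrier G" by (rule D(6))
qed (use assms(2) zip_datumD(7)[OF assms(1)] in auto)

text \<open>Each generating subgroup equals the \<psi>-image of its conjugate by w, and that
  conjugate lies in \<open>W I\<close>.\<close>

lemma zip_stab_subset:
  assumes "zip_datum K I \<psi>" "w \<in> carrier G"
  shows "zip_stab G I \<psi> w \<subseteq> W (\<psi> ` I)"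
proof -
  note D = zip_datumD[OF assms(1)]
  have "E \<subseteq> W (\<psi> ` I)" if "subgroup E G" "E \<subseteq> conj_set G (inv w) (W I)" "\<psi> ` conj_set G w E = E" for E
  proof -
    have "W I \<subseteq> carrier G" using W_closed[OF D(8)] by auto
    then have "conj_set G w E \<subseteq> W I"
      using subset_conj_set_inv_iff[OF assms(2) subgroup.subset[OF that(1)]] that(2) by simp
    then have "\<psi> ` conj_set G w E \<subseteq> W (\<psi> ` I)"
      using zip_datum_image[OF assms(1)] by auto
    then show ?thesis by (simp only: that(3))
  qed
  then have "\<Union>{E. subgroup E G \<and> E \<subseteq> conj_set G (inv w) (W I) \<and> \<psi> ` conj_set G w E = E}
      \<subseteq> W (\<psi> ` I)"
    by blast
  then show ?thesis
    unfolding zip_stab_def by (rule generate_subgroup_incl[OF _ W_subgroup[OF D(9)]])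
qed

lemma zip_equivI:
  assumes "d \<in> W I" "e \<in> zip_stab G I \<psi> w" "w' = d \<otimes> w \<otimes> e \<otimes> inv (\<psi> d)"
    and "w \<in> carrier G" "w' \<in> carrier G"
  shows "(w', w) \<in> zip_equiv G I \<psi>"
  using assms unfolding zip_equiv_def by blast

text \<open>With \<delta> = a d', cancelling a and moving \<psi> a to the left side turns one
  relation into the other; the new \<delta> is the conjugate of d' by the inverse of y.\<close>

lemma zip_equiv_double_min:
  assumes "zip_datum K I \<psi>" "J = \<psi> ` I" "y \<in> double_min I J" "a \<in> W I" "b \<in> W J" "u \<in> W J"
  shows "(a \<otimes> y \<otimes> b, y \<otimes> u) \<in> zip_equiv G I \<psi> \<longleftrightarrow>
    (b \<otimes> \<psi> a, u) \<in> zip_equiv G (conj_part y I J) (\<lambda>v. \<psi> (y \<otimes> v \<otimes> inv y))"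
    (is "?L \<longleftrightarrow> ?R")
proof -
  note D = zip_datumD[OF assms(1)]
  have J: "J \<subseteq> S" using D assms by simp
  have y: "y \<in> carrier G" using assms by (simp add: double_min_def)
  note cI = W_closed[OF D(8)] and cJ = W_closed[OF J]
  have \<psi>J: "\<psi> d \<in> W J" if "d \<in> W I" for d using zip_datum_image[OF assms(1) that] assms(2) by simp
  note \<psi>c = cJ[OF \<psi>J]
  note closed = cI[OF assms(4)] cJ[OF assms(5)] cJ[OF assms(6)] y \<psi>c[OF assms(4)]
  have stab: "zip_stab G I \<psi> (y \<otimes> u) =
      zip_stab G (conj_part y I J) (\<lambda>v. \<psi> (y \<otimes> v \<otimes> inv y)) u"
    using zip_stab_double_min[OF D(8) J _ assms(3,6)] \<psi>J by blast
  have stabJ: "e \<in> W J" if "e \<in> zip_stab G I \<psi> (y \<otimes> u)" for e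
    using zip_stab_subset[OF assms(1), of "y \<otimes> u"] that closed assms(2) by auto
  show ?thesis
  proof
    assume ?L
    then obtain d e where d: "d \<in> W I" and e: "e \<in> zip_stab G I \<psi> (y \<otimes> u)"
      and eq: "a \<otimes> y \<otimes> b = d \<otimes> (y \<otimes> u) \<otimes> e \<otimes> inv (\<psi> d)"
      by (auto simp: zip_equiv_def)
    note eJ = stabJ[OF e]
    define d' where "d' = inv a \<otimes> d"
    have d': "d' \<in> W I" using d assms(4) by (simp add: d'_def W_mult W_inv D)
    have d_eq: "d = a \<otimes> d'" using closed cI[OF d] by (simp add: d'_def)
    have \<psi>d: "\<psi> d = \<psi> a \<otimes> \<psi> d'" using D(7)[OF assms(4) d'] d_eq by simp
    note closed' = closed cI[OF d'] cJ[OF eJ] \<psi>c[OF d']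
    define g where "g = inv y \<otimes> d' \<otimes> y"
    have gc: "g \<in> carrier G" using closed' by (simp add: g_def)
    have yg: "y \<otimes> g \<otimes> inv y = d'" using closed' by (simp add: g_def m_assoc)
    have "a \<otimes> (y \<otimes> b) = a \<otimes> (d' \<otimes> y \<otimes> u \<otimes> e \<otimes> inv (\<psi> d') \<otimes> inv (\<psi> a))"
      using eq closed' by (simp add: d_eq[symmetric] \<psi>d inv_mult_group m_assoc) (simp add: d_eq m_assoc)
    then have "y \<otimes> b = d' \<otimes> y \<otimes> u \<otimes> e \<otimes> inv (\<psi> d') \<otimes> inv (\<psi> a)"
      using closed' by simp
    then have "b = inv y \<otimes> (d' \<otimes> y \<otimes> u \<otimes> e \<otimes> inv (\<psi> d') \<otimes> inv (\<psi> a))"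
      using closed' by (simp flip: \<open>y \<otimes> b = _\<close>)
    then have b\<psi>: "b \<otimes> \<psi> a = g \<otimes> u \<otimes> e \<otimes> inv (\<psi> d')"
      using closed' by (simp add: g_def m_assoc)
    \<comment> \<open>Solving for g expresses it through elements of \<open>W J\<close>, while its
      conjugate by y is d' in \<open>W I\<close>; hence Kilmoyer's lemma applies to g.\<close>
    have "g = (b \<otimes> \<psi> a) \<otimes> \<psi> d' \<otimes> inv e \<otimes> inv u"
      unfolding b\<psi> using closed' gc by (simp add: m_assoc)
    then have "g \<in> W J"
      using assms(4-6) eJ d' J by (simp add: W_mult W_inv \<psi>J)
    then have "g \<in> W (conj_part y I J)"
      using W_conj_partI[OF D(8) J assms(3)] yg d' by simp
    moreover have "b \<otimes> \<psi> a = g \<otimes> u \<otimes> e \<otimes> inv (\<psi> (y \<otimes> g \<otimes> inv y))"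
      using b\<psi> yg by simp
    moreover have "b \<otimes> \<psi> a \<in> carrier G" using closed by simp
    ultimately show ?R
      using e closed(3) unfolding stab by (intro zip_equivI)
  next
    assume ?R
    then obtain g e where g: "g \<in> W (conj_part y I J)" and e: "e \<in> zip_stab G I \<psi> (y \<otimes> u)"
      and eq: "b \<otimes> \<psi> a = g \<otimes> u \<otimes> e \<otimes> inv (\<psi> (y \<otimes> g \<otimes> inv y))"
      by (auto simp: zip_equiv_def stab)
    define d where "d = y \<otimes> g \<otimes> inv y"
    have d: "d \<in> W I" using W_conj_part_conj[OF D(8) J y g] by (simp add: d_def)
    have gc: "g \<in> carrier G" using W_closed[of "conj_part y I J" g] g J by blast
    note closed' = closed cI[OF d] cJ[OF stabJ[OF e]] \<psi>c[OF d] gc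
    have "b = (b \<otimes> \<psi> a) \<otimes> inv (\<psi> a)" using closed' by (simp add: m_assoc)
    also have "\<dots> = g \<otimes> u \<otimes> e \<otimes> inv (\<psi> d) \<otimes> inv (\<psi> a)" by (simp add: eq d_def)
    finally have b: "b = g \<otimes> u \<otimes> e \<otimes> inv (\<psi> d) \<otimes> inv (\<psi> a)" .
    have yg: "y \<otimes> g = d \<otimes> y" using closed' by (simp add: d_def m_assoc)
    have "a \<otimes> y \<otimes> b = a \<otimes> (y \<otimes> g) \<otimes> u \<otimes> e \<otimes> inv (\<psi> d) \<otimes> inv (\<psi> a)"
      by (subst b) (use closed' in \<open>simp add: m_assoc\<close>)
    also have "\<dots> = (a \<otimes> d) \<otimes> (y \<otimes> u) \<otimes> e \<otimes> inv (\<psi> (a \<otimes> d))"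
      unfolding yg D(7)[OF assms(4) d] using closed' by (simp add: m_assoc inv_mult_group)
    finally have "a \<otimes> y \<otimes> b = (a \<otimes> d) \<otimes> (y \<otimes> u) \<otimes> e \<otimes> inv (\<psi> (a \<otimes> d))" .
    moreover have "y \<otimes> u \<in> carrier G" "a \<otimes> y \<otimes> b \<in> carrier G" using closed by auto
    ultimately show ?L
      using e W_mult[OF assms(4) d] by (intro zip_equivI)
  qed
qed

text \<open>Conjugation by y embeds \<open>conj_part y I J\<close> into I, and \<psi> carries I onto
  J, which becomes the new ambient set.\<close>

lemma zip_datum_double_min:
  assumes "zip_datum K I \<psi>" "J = \<psi> ` I" "y \<in> double_min I J"
  shows "zip_datum J (conj_part y I J) (\<lambda>v. \<psi> (y \<otimes> v \<otimes> inv y))"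
proof -
  note D = zip_datumD[OF assms(1)]
  have J: "J \<subseteq> S" using D assms by simp
  have y: "y \<in> carrier G" using assms by (simp add: double_min_def)
  have sub: "conj_part y I J \<subseteq> S" using J by auto
  note closed = W_closed[OF sub]
  note conj = W_conj_part_conj[OF D(8) J y]
  have "inj_on (\<lambda>v. \<psi> (y \<otimes> v \<otimes> inv y)) (conj_part y I J)"
  proof (rule inj_onI)
    fix s t assume st: "s \<in> conj_part y I J" "t \<in> conj_part y I J"
      and "\<psi> (y \<otimes> s \<otimes> inv y) = \<psi> (y \<otimes> t \<otimes> inv y)"
    then have "y \<otimes> s \<otimes> inv y = y \<otimes> t \<otimes> inv y" using D(5) by (auto dest: inj_onD)
    moreover have "s \<in> carrier G" "t \<in> carrier G" using st sub by auto
    ultimately show "s = t" using y by simp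
  qed
  moreover have "\<psi> (y \<otimes> (v \<otimes> w) \<otimes> inv y) = \<psi> (y \<otimes> v \<otimes> inv y) \<otimes> \<psi> (y \<otimes> w \<otimes> inv y)"
    if "v \<in> W (conj_part y I J)" "w \<in> W (conj_part y I J)" for v w
  proof -
    have "y \<otimes> (v \<otimes> w) \<otimes> inv y = (y \<otimes> v \<otimes> inv y) \<otimes> (y \<otimes> w \<otimes> inv y)"
      using closed[OF that(1)] closed[OF that(2)] y by (simp add: m_assoc)
    then show ?thesis using D(7) conj that by simp
  qed
  ultimately show ?thesis
    using J D(2,6) conj assms(2) unfolding zip_datum_def by auto
qed

section \<open>Existence and uniqueness of representatives by induction\<close>

lemma one_min_left_reps: "\<one> \<in> min_left_reps G S I"
proof -
  have "len \<one> = 0" by (simp add: len_eq_0_iff)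
  then show ?thesis by (simp add: min_left_reps_iff)
qed

text \<open>Here \<psi> permutes the finite set I, so it maps \<open>W I\<close> onto itself and the
  stabilizer of \<one> contains all of \<open>W I\<close>. Thus every w is related to \<one>, the
  only minimal representative inside \<open>W I\<close>.\<close>

lemma zip_equiv_unique_full:
  assumes "zip_datum I I \<psi>" "w \<in> W I"
  shows "\<exists>!x. x \<in> min_left_reps G S I \<and> x \<in> W I \<and> (w, x) \<in> zip_equiv G I \<psi>"
proof -
  note D = zip_datumD[OF assms(1)]
  have WI: "W I \<subseteq> carrier G" using W_closed D by blast
  have \<psi>I: "\<psi> ` I = I" using endo_inj_surj[OF D(2,4,5)] .
  \<comment> \<open>A zip datum only records multiplicativity, so the image of the unit is
    identified as an idempotent.\<close>
  have "\<psi> \<one> \<otimes> \<psi> \<one> = \<psi> \<one>" "\<psi> \<one> \<in> carrier G"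
    using D(6) D(7)[of \<one> \<one>] generate.one[of G I] by auto
  then have \<psi>1: "\<psi> \<one> = \<one>" using l_cancel_one by blast
  have "weval xs \<in> \<psi> ` W I" if "set xs \<subseteq> I" for xs
    using that
  proof (induction xs)
    case Nil
    show ?case using \<psi>1 generate.one[of G I] by force
  next
    case (Cons s xs)
    then obtain a where a: "a \<in> W I" "weval xs = \<psi> a" by auto
    have "s \<in> \<psi> ` I" using Cons.prems \<psi>I by simp
    then obtain r where r: "r \<in> W I" "s = \<psi> r" by (auto intro: generate.incl)
    have "weval (s # xs) = \<psi> (r \<otimes> a)" using a r D(7) by simp
    with W_mult a r show ?case by blast
  qed
  then have "W I \<subseteq> \<psi> ` W I" using W_word[OF D(8)] by (metis subsetI)
  moreover have "\<psi> ` W I \<subseteq> W I" using zip_datum_image[OF assms(1)] \<psi>I by auto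
  ultimately have \<psi>W: "\<psi> ` W I = W I" by blast
  have "conj_set G \<one> (W I) = W I"
    using WI by (force simp: conj_set_def subset_iff)
  then have "W I \<in> {E. subgroup E G \<and> E \<subseteq> conj_set G (inv \<one>) (W I) \<and> \<psi> ` conj_set G \<one> E = E}"
    using \<psi>W W_subgroup[OF D(8)] by simp
  then have "W I \<subseteq> zip_stab G I \<psi> \<one>"
    unfolding zip_stab_def by (blast intro: generate.incl)
  \<comment> \<open>The witnesses are \<delta> = \<one> and \<epsilon> = w.\<close>
  then have "(w, \<one>) \<in> zip_equiv G I \<psi>"
    using assms(2) WI \<psi>1 by (intro zip_equivI[OF generate.one, of w]) auto
  moreover have "x = \<one>" if "x \<in> min_left_reps G S I" "x \<in> W I" for x
    using min_left_reps_unique[OF D(8) one_min_left_reps that(2)] that(1) WI that(2) by auto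
  ultimately show ?thesis
    using one_min_left_reps generate.one[of G I] by blast
qed

text \<open>K is generalized in the induction because the reduced datum lives in the ambient group
  \<open>W J\<close>.\<close>

lemma zip_equiv_unique:
  assumes "zip_datum K I \<psi>" "w \<in> W K"
  shows "\<exists>!x. x \<in> min_left_reps G S I \<and> x \<in> W K \<and> (w, x) \<in> zip_equiv G I \<psi>"
  using assms
proof (induction "card I" arbitrary: K I \<psi> w rule: less_induct)
  case less
  note D = zip_datumD[OF less.prems(1)]
  define J where "J = \<psi> ` I"
  have J: "J \<subseteq> S" "J \<subseteq> K" "finite J" using D by (auto simp: J_def)
  have mono: "W I \<subseteq> W K" "W J \<subseteq> W K" using D(3) J(2) by (auto intro: mono_generate[THEN subsetD])
  have wc: "w \<in> carrier G" using W_closed[OF D(1) less.prems(2)] .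
  obtain a y b where a: "a \<in> W I" and y: "y \<in> double_min I J" and b: "b \<in> W J"
    and w: "w = a \<otimes> y \<otimes> b"
    using double_min_exists[OF D(8) J(1) wc] .
  note cI = W_closed[OF D(8)] and cJ = W_closed[OF J(1)]
  have yc: "y \<in> carrier G" using y by (simp add: double_min_def)
  have \<psi>J: "\<psi> d \<in> W J" if "d \<in> W I" for d
    using zip_datum_image[OF less.prems(1) that] by (simp add: J_def)
  have "y = inv a \<otimes> w \<otimes> inv b" using w cI[OF a] cJ[OF b] yc by (simp add: m_assoc)
  then have yK: "y \<in> W K" using less.prems(2) a b mono D(1) by (auto intro!: W_mult W_inv)
  let ?I = "conj_part y I J" and ?\<psi> = "\<lambda>v. \<psi> (y \<otimes> v \<otimes> inv y)"
  have datum: "zip_datum J ?I ?\<psi>"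
    using zip_datum_double_min[OF less.prems(1) J_def y] .
  have "\<exists>!u. u \<in> min_left_reps G S ?I \<and> u \<in> W J \<and> (b \<otimes> \<psi> a, u) \<in> zip_equiv G ?I ?\<psi>"
  \<comment> \<open>If the two sets agree, the reduced datum is an automorphism of
    \<open>W J\<close>. Otherwise \<open>?I\<close> is a proper subset of J, which has at most as
    many elements as I.\<close>
  proof (cases "?I = J")
    case True
    with zip_equiv_unique_full[of J ?\<psi> "b \<otimes> \<psi> a"] datum b \<psi>J[OF a] show ?thesis
      by (simp add: W_mult)
  next
    case False
    then have "card ?I < card J" using J by (intro psubset_card_mono) auto
    also have "card J \<le> card I" unfolding J_def by (rule card_image_le[OF D(2)])
    finally show ?thesis using less.hyps datum b \<psi>J[OF a] W_mult by blast
  qed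
  then obtain u where u: "u \<in> min_left_reps G S ?I" "u \<in> W J"
      "(b \<otimes> \<psi> a, u) \<in> zip_equiv G ?I ?\<psi>"
    and uniq: "\<And>v. v \<in> min_left_reps G S ?I \<Longrightarrow> v \<in> W J \<Longrightarrow>
      (b \<otimes> \<psi> a, v) \<in> zip_equiv G ?I ?\<psi> \<Longrightarrow> v = u"
    by blast
  note iff = zip_equiv_double_min[OF less.prems(1) J_def y a b]
  show ?case
  proof (rule ex1I[of _ "y \<otimes> u"], intro conjI)
    show "y \<otimes> u \<in> min_left_reps G S I"
      using double_min_mult_min_left_reps[OF D(8) J(1) y u(2,1)] .
    show "y \<otimes> u \<in> W K" using W_mult yK u(2) mono by blast
    show "(w, y \<otimes> u) \<in> zip_equiv G I \<psi>" using iff[OF u(2)] u(3) w by simp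
  next
    fix x assume x: "x \<in> min_left_reps G S I \<and> x \<in> W K \<and> (w, x) \<in> zip_equiv G I \<psi>"
    then obtain d e where de: "d \<in> W I" "e \<in> zip_stab G I \<psi> x"
      and eq: "w = d \<otimes> x \<otimes> e \<otimes> inv (\<psi> d)"
      by (auto simp: zip_equiv_def)
    have xc: "x \<in> carrier G" using x min_left_reps_closed by blast
    have e: "e \<in> W J" using zip_stab_subset[OF less.prems(1) xc] de(2) by (auto simp: J_def)
    note closed = cI[OF a] cJ[OF b] yc xc cI[OF de(1)] cJ[OF e] cJ[OF \<psi>J[OF de(1)]]
    \<comment> \<open>Because \<psi> d and e lie in \<open>W J\<close>, x lies in the double coset
      of w and hence has the form y v.\<close>
    have "x = inv d \<otimes> w \<otimes> (\<psi> d \<otimes> inv e)"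
      unfolding eq using closed by (simp add: m_assoc)
    then have "x = (inv d \<otimes> a) \<otimes> y \<otimes> (b \<otimes> (\<psi> d \<otimes> inv e))"
      unfolding w using closed by (simp add: m_assoc)
    moreover have "inv d \<otimes> a \<in> W I" using W_mult W_inv[OF D(8) de(1)] a by blast
    moreover have "b \<otimes> (\<psi> d \<otimes> inv e) \<in> W J"
      using b e \<psi>J[OF de(1)] J(1) by (simp add: W_mult W_inv)
    ultimately obtain v where v: "v \<in> W J" "v \<in> min_left_reps G S ?I" "x = y \<otimes> v"
      using min_left_reps_double_coset[OF D(8) J(1) y] x by blast
    with x w iff[OF v(1)] uniq show "x = y \<otimes> u" by blast
  qed
qed

end

theorem theorem9p11:
  fixes G :: "('a, 'b) monoid_scheme" (structure)
    and S I J :: "'a set" and \<psi> :: "'a \<Rightarrow> 'a"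
  assumes "coxeter_system G S"
    and "finite S"
    and "I \<subseteq> S" and "J \<subseteq> S"
    and "\<psi> \<in> iso (G\<lparr>carrier := generate G I\<rparr>) (G\<lparr>carrier := generate G J\<rparr>)"
    and "\<psi> ` I = J"
  shows "representatives (carrier G) (zip_equiv G I \<psi>) (min_left_reps G S I)"
proof -
  interpret coxeter_system G S by (rule assms(1))
  have hom: "\<psi> \<in> hom (G\<lparr>carrier := W I\<rparr>) (G\<lparr>carrier := W J\<rparr>)" and inj: "inj_on \<psi> (W I)"
    using assms(5) by (auto simp: iso_def bij_betw_def)
  have "inj_on \<psi> I" using inj by (rule inj_on_subset) (auto intro: generate.incl)
  moreover have "\<psi> ` W I \<subseteq> W J" using hom by (auto simp: hom_def)
  ultimately have datum: "zip_datum S I \<psi>"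
    using assms(2-4,6) hom W_closed[OF assms(4)] finite_subset[OF assms(3,2)]
    unfolding zip_datum_def by (auto simp: hom_def)
  \<comment> \<open>A member of the quotient is the image of a singleton under the relation; this
    matches the pairs (w, x) with the representative in second place.\<close>
  have "\<exists>!x. x \<in> min_left_reps G S I \<and> x \<in> zip_equiv G I \<psi> `` {w}" if "w \<in> carrier G" for w
    using zip_equiv_unique[OF datum, of w] that S_generates min_left_reps_closed[of _ I] by auto
  then show ?thesis
    unfolding representatives_def quotient_def using min_left_reps_closed by blast
qed

end
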